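(* Let $S$ be the medial quandle of an ia-mesh $(S_i,\sigma_{i,j},s_{i,j})_{i,j\in I}$ and let $T$ be the medial quandle of an ia-mesh $(T_i,\tau_{i,j},t_{i,j})_{i,j\in J}$. Let $g:I\to J$ be a mapping. Then there exists a quandle homomorphism $h:S\to T$ with $\hat h=g$ if and only if for every $i\in I$ there exist a group homomorphism $k_i:S_i\to T_{g(i)}$ and an element $e_i\in T_{g(i)}$ such that for every $i,j\in I$: (i) $k_j\circ\sigma_{i,j}=\tau_{g(i),g(j)}\circ k_i$; (ii) $k_j(s_{i,j})=t_{g(i),g(j)}+\tau_{g(i),g(j)}(e_i)-\tau_{g(j),g(j)}(e_j)$.
   Context: A quandle is a set $Q$ with a binary operation $\triangleright$ such that $x\triangleright x=x$; for all $y,z$ there is a unique $x$ with $y\triangleright x=z$; and $x\triangleright(y\triangleright z)=(x\triangleright y)\triangleright(x\triangleright z)$. It is medial if $(x\triangleright y)\triangleright(z\triangleright w)=(x\triangleright z)\triangleright(y\triangleright w)$ for all $x,y,z,w$. The components of $Q$ are the orbits of the group generated by the bijections $L_a:x\mapsto a\triangleright x$, $a\in Q$. An ia-mesh (indecomposable affine mesh) over an index set $I$ is a triple $(A_i,\phi_{i,j},c_{i,j})_{i,j\in I}$ of abelian groups $A_i$, group homomorphisms $\phi_{i,j}:A_i\to A_j$ and elements $c_{i,j}\in A_j$ such that for all indices $i,j,j',k$: (1) $1-\phi_{i,i}$ is an automorphism of $A_i$; (2) $c_{i,i}=0$; (3) $\phi_{j,k}\circ\phi_{i,j}=\phi_{j',k}\circ\phi_{i,j'}$;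 (4) $\phi_{j,k}(c_{i,j})=\phi_{k,k}(c_{i,k}-c_{j,k})$; (5) for each $j$, the group $A_j$ is generated by all elements $c_{i,j}$ and $\phi_{i,j}(a)$ with $i\in I$, $a\in A_i$. The quandle of the ia-mesh is the disjoint union $\bigcup_{i\in I}A_i$ with $a\triangleright b=c_{i,j}+\phi_{i,j}(a)+(1-\phi_{j,j})(b)$ for $a\in A_i$, $b\in A_j$. It is known that this is a medial quandle whose components are exactly the sets $A_i$, $i\in I$ (and every medial quandle arises this way); so its set of components is identified with $I$. A quandle homomorphism $h:S\to T$ maps each component of $S$ into a component of $T$; $\hat h$ denotes the induced map on components, here viewed as a map $I\to J$, i.e. $h(S_i)\subseteq T_{\hat h(i)}$. *)

theory Defs
  imports "HOL-Algebra.Algebra"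
begin


section \<open>Quandles\<close>

record 'a quandle_struct = "'a partial_object" +
  qop :: "'a \<Rightarrow> 'a \<Rightarrow> 'a"  (infixl "\<triangleright>\<index>" 70)

locale quandle =
  fixes Q (structure)
  assumes closed: "x \<in> carrier Q \<Longrightarrow> y \<in> carrier Q \<Longrightarrow> x \<triangleright> y \<in> carrier Q"
    and idem: "x \<in> carrier Q \<Longrightarrow> x \<triangleright> x = x"
    and left_div: "y \<in> carrier Q \<Longrightarrow> z \<in> carrier Q \<Longrightarrow> \<exists>!x. x \<in> carrier Q \<and> y \<triangleright> x = z"
    and left_distrib: "x \<in> carrier Q \<Longrightarrow> y \<in> carrier Q \<Longrightarrow> z \<in> carrier Q \<Longrightarrow>
      x \<triangleright> (y \<triangleright> z) = (x \<triangleright> y) \<triangleright> (x \<triangleright> z)"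

locale medial_quandle = quandle +
  assumes medial: "x \<in> carrier Q \<Longrightarrow> y \<in> carrier Q \<Longrightarrow> z \<in> carrier Q \<Longrightarrow> w \<in> carrier Q \<Longrightarrow>
      (x \<triangleright> y) \<triangleright> (z \<triangleright> w) = (x \<triangleright> z) \<triangleright> (y \<triangleright> w)"

definition left_mult :: "('a, 'm) quandle_struct_scheme \<Rightarrow> 'a \<Rightarrow> 'a \<Rightarrow> 'a" where
  "left_mult Q a = (\<lambda>x\<in>carrier Q. a \<triangleright>\<^bsub>Q\<^esub> x)"

lemma (in quandle) left_mult_Bij:
  assumes "a \<in> carrier Q" shows "left_mult Q a \<in> Bij (carrier Q)"
proof -
  have "bij_betw (left_mult Q a) (carrier Q) (carrier Q)"
    unfolding bij_betw_def inj_on_def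
  proof (intro conjI ballI impI equalityI subsetI)
    fix x y assume "x \<in> carrier Q" "y \<in> carrier Q" "left_mult Q a x = left_mult Q a y"
    then show "x = y" using left_div[OF assms closed[OF assms]] by (auto simp: left_mult_def)
  next
    fix y assume "y \<in> left_mult Q a ` carrier Q"
    then show "y \<in> carrier Q" using closed assms by (auto simp: left_mult_def)
  next
    fix y assume "y \<in> carrier Q"
    then obtain x where "x \<in> carrier Q" "a \<triangleright> x = y" using left_div[OF assms] by blast
    then show "y \<in> left_mult Q a ` carrier Q" by (auto simp: left_mult_def image_iff intro!: bexI[of _ x])
  qed
  then show ?thesis by (simp add: Bij_def left_mult_def)
qed

definition left_mult_group :: "('a, 'm) quandle_struct_scheme \<Rightarrow> ('a \<Rightarrow> 'a) monoid" where
  "left_mult_group Q = BijGroup (carrier Q)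
     \<lparr>carrier := generate (BijGroup (carrier Q)) (left_mult Q ` carrier Q)\<rparr>"

definition components :: "('a, 'm) quandle_struct_scheme \<Rightarrow> 'a set set" where
  "components Q = orbits (left_mult_group Q) (carrier Q) (\<lambda>f. f)"

definition quandle_hom ::
    "('a, 'm) quandle_struct_scheme \<Rightarrow> ('b, 'n) quandle_struct_scheme \<Rightarrow> ('a \<Rightarrow> 'b) set" where
  "quandle_hom Q R = {h \<in> carrier Q \<rightarrow> carrier R.
     \<forall>x\<in>carrier Q. \<forall>y\<in>carrier Q. h (x \<triangleright>\<^bsub>Q\<^esub> y) = h x \<triangleright>\<^bsub>R\<^esub> h y}"

text \<open>The map on components induced by a quandle homomorphism \<open>h : Q \<rightarrow> R\<close>.  It is only meaningful
  when \<open>h\<close> is a homomorphism and \<open>C\<close> is a component of \<open>Q\<close>.\<close>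

definition component_map ::
    "('b, 'n) quandle_struct_scheme \<Rightarrow> ('a \<Rightarrow> 'b) \<Rightarrow> 'a set \<Rightarrow> 'b set"
  where "component_map R h C = (THE D. D \<in> components R \<and> h ` C \<subseteq> D)"


section \<open>Indecomposable affine meshes\<close>

text \<open>The abelian groups are \<^locale>\<open>comm_group\<close> structures, hence written multiplicatively:
  \<open>\<otimes>\<close>, \<open>inv\<close> and \<open>\<one>\<close> are the addition, negation and zero of the mesh, and \<open>1 - \<phi> i i\<close> is
  \<open>\<lambda>a. a \<otimes> inv (\<phi> i i a)\<close>.  The groups of one mesh have carriers inside a common type, but are
  otherwise unrelated.\<close>

locale ia_mesh =
  fixes I :: "'i set"
    and A :: "'i \<Rightarrow> ('a, 'm) monoid_scheme"
    and \<phi> :: "'i \<Rightarrow> 'i \<Rightarrow> 'a \<Rightarrow> 'a"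
    and c :: "'i \<Rightarrow> 'i \<Rightarrow> 'a"
  assumes comm_group: "i \<in> I \<Longrightarrow> comm_group (A i)"
    and hom: "i \<in> I \<Longrightarrow> j \<in> I \<Longrightarrow> \<phi> i j \<in> hom (A i) (A j)"
    and const_closed: "i \<in> I \<Longrightarrow> j \<in> I \<Longrightarrow> c i j \<in> carrier (A j)"
    and one_minus_iso: "i \<in> I \<Longrightarrow> (\<lambda>a. a \<otimes>\<^bsub>A i\<^esub> inv\<^bsub>A i\<^esub> (\<phi> i i a)) \<in> iso (A i) (A i)"
    and const_diag: "i \<in> I \<Longrightarrow> c i i = \<one>\<^bsub>A i\<^esub>"
    and hom_comp: "i \<in> I \<Longrightarrow> j \<in> I \<Longrightarrow> j' \<in> I \<Longrightarrow> k \<in> I \<Longrightarrow> a \<in> carrier (A i) \<Longrightarrow>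
      \<phi> j k (\<phi> i j a) = \<phi> j' k (\<phi> i j' a)"
    and hom_const: "i \<in> I \<Longrightarrow> j \<in> I \<Longrightarrow> k \<in> I \<Longrightarrow>
      \<phi> j k (c i j) = \<phi> k k (c i k \<otimes>\<^bsub>A k\<^esub> inv\<^bsub>A k\<^esub> (c j k))"
    and generated: "j \<in> I \<Longrightarrow>
      generate (A j) ({c i j | i. i \<in> I} \<union> {\<phi> i j a | i a. i \<in> I \<and> a \<in> carrier (A i)}) = carrier (A j)"

text \<open>The disjoint union of the groups is the set of pairs \<open>(i, a)\<close> with \<open>a\<close> in the group \<open>A i\<close>.\<close>

definition mesh_quandle ::
    "'i set \<Rightarrow> ('i \<Rightarrow> ('a, 'm) monoid_scheme) \<Rightarrow> ('i \<Rightarrow> 'i \<Rightarrow> 'a \<Rightarrow> 'a) \<Rightarrow> ('i \<Rightarrow> 'i \<Rightarrow> 'a) \<Rightarrow>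
      ('i \<times> 'a) quandle_struct" where
  "mesh_quandle I A \<phi> c =
    \<lparr>carrier = (SIGMA i:I. carrier (A i)),
     qop = (\<lambda>(i, a) (j, b). (j, c i j \<otimes>\<^bsub>A j\<^esub> \<phi> i j a \<otimes>\<^bsub>A j\<^esub> (b \<otimes>\<^bsub>A j\<^esub> inv\<^bsub>A j\<^esub> (\<phi> j j b))))\<rparr>"

text \<open>The component with index \<open>i\<close>; that these are exactly the components of the mesh quandle is
  \<open>components_mesh\<close> below.\<close>

definition mesh_component :: "('i \<Rightarrow> ('a, 'm) monoid_scheme) \<Rightarrow> 'i \<Rightarrow> ('i \<times> 'a) set" where
  "mesh_component A i = {i} \<times> carrier (A i)"

subsection \<open>The quandle of a mesh is medial, and its components are the groups of the mesh\<close>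

context ia_mesh begin

abbreviation (input) "Q \<equiv> mesh_quandle I A \<phi> c"

lemma carrier_mesh: "carrier Q = (SIGMA i:I. carrier (A i))"
  by (simp add: mesh_quandle_def)

lemma op_mesh: "(i, a) \<triangleright>\<^bsub>Q\<^esub> (j, b) =
    (j, c i j \<otimes>\<^bsub>A j\<^esub> \<phi> i j a \<otimes>\<^bsub>A j\<^esub> (b \<otimes>\<^bsub>A j\<^esub> inv\<^bsub>A j\<^esub> (\<phi> j j b)))"
  by (simp add: mesh_quandle_def)

lemma hom_closed: "i \<in> I \<Longrightarrow> j \<in> I \<Longrightarrow> a \<in> carrier (A i) \<Longrightarrow> \<phi> i j a \<in> carrier (A j)"
  using hom by (auto simp: hom_def)

lemma grp: "i \<in> I \<Longrightarrow> group (A i)"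
  using comm_group comm_group_def by blast

lemma hom_mult: "i \<in> I \<Longrightarrow> j \<in> I \<Longrightarrow> a \<in> carrier (A i) \<Longrightarrow> b \<in> carrier (A i) \<Longrightarrow>
   \<phi> i j (a \<otimes>\<^bsub>A i\<^esub> b) = \<phi> i j a \<otimes>\<^bsub>A j\<^esub> \<phi> i j b"
  using hom by (auto simp: hom_def)

lemma hom_inv: "i \<in> I \<Longrightarrow> j \<in> I \<Longrightarrow> a \<in> carrier (A i) \<Longrightarrow>
   \<phi> i j (inv\<^bsub>A i\<^esub> a) = inv\<^bsub>A j\<^esub> (\<phi> i j a)"
  by (rule group_hom.hom_inv) (auto simp: group_hom_def group_hom_axioms_def grp hom)

lemma hom_one: "i \<in> I \<Longrightarrow> j \<in> I \<Longrightarrow> \<phi> i j \<one>\<^bsub>A i\<^esub> = \<one>\<^bsub>A j\<^esub>"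
  by (rule group_hom.hom_one) (auto simp: group_hom_def group_hom_axioms_def grp hom)

lemma hom_const': "i \<in> I \<Longrightarrow> j \<in> I \<Longrightarrow> k \<in> I \<Longrightarrow>
      \<phi> j k (c i j) = \<phi> k k (c i k) \<otimes>\<^bsub>A k\<^esub> inv\<^bsub>A k\<^esub> \<phi> k k (c j k)"
  by (subst hom_const) (simp_all add: const_closed hom_mult hom_inv grp group.inv_closed)

lemma hom_comp': "i \<in> I \<Longrightarrow> j \<in> I \<Longrightarrow> k \<in> I \<Longrightarrow> a \<in> carrier (A i) \<Longrightarrow>
      \<phi> j k (\<phi> i j a) = \<phi> k k (\<phi> i k a)"
  by (rule hom_comp)

lemma op_closed:
  assumes "i \<in> I" "j \<in> I" "a \<in> carrier (A i)" "b \<in> carrier (A j)"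
  shows "c i j \<otimes>\<^bsub>A j\<^esub> \<phi> i j a \<otimes>\<^bsub>A j\<^esub> (b \<otimes>\<^bsub>A j\<^esub> inv\<^bsub>A j\<^esub> (\<phi> j j b)) \<in> carrier (A j)"
proof -
  interpret comm_group "A j" using comm_group assms by blast
  show ?thesis using assms by (simp add: const_closed hom_closed)
qed

lemma mesh_carrierE: "x \<in> carrier Q \<Longrightarrow> (\<And>i a. x = (i,a) \<Longrightarrow> i \<in> I \<Longrightarrow> a \<in> carrier (A i) \<Longrightarrow> P) \<Longrightarrow> P"
  by (auto simp: carrier_mesh)

lemma mesh_medial:
  assumes I: "i \<in> I" "j \<in> I" "k \<in> I" "l \<in> I"
    and C: "x \<in> carrier (A i)" "y \<in> carrier (A j)" "z \<in> carrier (A k)" "w \<in> carrier (A l)"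
  shows "((i,x) \<triangleright>\<^bsub>Q\<^esub> (j,y)) \<triangleright>\<^bsub>Q\<^esub> ((k,z) \<triangleright>\<^bsub>Q\<^esub> (l,w)) = ((i,x) \<triangleright>\<^bsub>Q\<^esub> (k,z)) \<triangleright>\<^bsub>Q\<^esub> ((j,y) \<triangleright>\<^bsub>Q\<^esub> (l,w))"
proof -
  interpret j: comm_group "A j" using comm_group I by blast
  interpret k: comm_group "A k" using comm_group I by blast
  interpret comm_group "A l" using comm_group I by blast
  note simps = I C const_closed hom_closed hom_mult hom_inv hom_const'[of _ j l] hom_const'[of _ k l]
    hom_comp'[of _ j l] hom_comp'[of _ k l]
  show ?thesis
    by (simp add: op_mesh simps inv_mult m_ac)
qed

lemma mesh_idem: assumes "i \<in> I" "x \<in> carrier (A i)" shows "(i,x) \<triangleright>\<^bsub>Q\<^esub> (i,x) = (i,x)"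
proof -
  interpret comm_group "A i" using comm_group assms by blast
  show ?thesis using assms hom_closed[of i i x]
    by (simp add: op_mesh const_diag) (simp add: m_lcomm[of _ x])
qed

lemma mesh_left_div:
  assumes I: "i \<in> I" "j \<in> I" and C: "x \<in> carrier (A i)" "y \<in> carrier (A j)" 
  shows "\<exists>!z. z \<in> carrier Q \<and> (i,x) \<triangleright>\<^bsub>Q\<^esub> z = (j,y)"
proof -
  interpret comm_group "A j" using comm_group I by blast
  let ?f = "(\<lambda>a. a \<otimes>\<^bsub>A j\<^esub> inv\<^bsub>A j\<^esub> (\<phi> j j a))"
  let ?d = "c i j \<otimes>\<^bsub>A j\<^esub> \<phi> i j x"
  have d: "?d \<in> carrier (A j)" using I C by (simp add: const_closed hom_closed)
  have b: "bij_betw ?f (carrier (A j)) (carrier (A j))" using one_minus_iso[OF I(2)] by (simp add: iso_def)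
  then have bb: "?f z \<in> carrier (A j)" if "z \<in> carrier (A j)" for z using that bij_betwE by auto 
  obtain z where z: "z \<in> carrier (A j)" "?f z = inv\<^bsub>A j\<^esub> ?d \<otimes>\<^bsub>A j\<^esub> y"
  proof -
    have "inv\<^bsub>A j\<^esub> ?d \<otimes>\<^bsub>A j\<^esub> y \<in> ?f ` carrier (A j)"
      using b C(2) d unfolding bij_betw_def by (metis inv_closed m_closed)
    then show thesis using that by auto
  qed
  show ?thesis
  proof (rule ex1I[of _ "(j,z)"])
    show "(j, z) \<in> carrier Q \<and> (i, x) \<triangleright>\<^bsub>Q\<^esub> (j, z) = (j, y)"
      using z I C d by (simp add: carrier_mesh op_mesh m_assoc[symmetric])
  next
    fix u assume u: "u \<in> carrier Q \<and> (i, x) \<triangleright>\<^bsub>Q\<^esub> u = (j, y)"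
    then obtain v where v: "u = (j,v)" "v \<in> carrier (A j)" by (auto simp: carrier_mesh op_mesh)
    have "?d \<otimes>\<^bsub>A j\<^esub> ?f v = y" using u v by (simp add: op_mesh)
    then have "?f v = inv\<^bsub>A j\<^esub> ?d \<otimes>\<^bsub>A j\<^esub> y" using d bb[OF v(2)] by (metis inv_solve_left' C(2))
    then have "?f v = ?f z" using z by simp
    then have "v = z" using b v z unfolding bij_betw_def inj_on_def by blast
    then show "u = (j,z)" using v by simp
  qed
qed

lemma medial_quandle_mesh: "medial_quandle Q"
proof
  fix x y assume "x \<in> carrier Q" "y \<in> carrier Q" then show "x \<triangleright>\<^bsub>Q\<^esub> y \<in> carrier Q"
   by (auto simp: carrier_mesh op_mesh op_closed)
next
  fix x assume "x \<in> carrier Q" then show "x \<triangleright>\<^bsub>Q\<^esub> x = x" by (auto simp: carrier_mesh mesh_idem)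
next
  fix x y assume "x \<in> carrier Q" "y \<in> carrier Q" then show "\<exists>!z. z \<in> carrier Q \<and> x \<triangleright>\<^bsub>Q\<^esub> z = y"
    by (elim mesh_carrierE) (simp add: mesh_left_div)
next
  fix x y z w assume  "x \<in> carrier Q" "y \<in> carrier Q" "z \<in> carrier Q" "w \<in> carrier Q"
  then show m: "(x \<triangleright>\<^bsub>Q\<^esub> y) \<triangleright>\<^bsub>Q\<^esub> (z \<triangleright>\<^bsub>Q\<^esub> w) = (x \<triangleright>\<^bsub>Q\<^esub> z) \<triangleright>\<^bsub>Q\<^esub> (y \<triangleright>\<^bsub>Q\<^esub> w)"
    by (elim mesh_carrierE) (simp only: mesh_medial)
next
  fix x y z assume *: "x \<in> carrier Q" "y \<in> carrier Q" "z \<in> carrier Q" 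
  have "x \<triangleright>\<^bsub>Q\<^esub> (y \<triangleright>\<^bsub>Q\<^esub> z) = (x \<triangleright>\<^bsub>Q\<^esub> x) \<triangleright>\<^bsub>Q\<^esub> (y \<triangleright>\<^bsub>Q\<^esub> z)" using * by (auto simp: carrier_mesh mesh_idem)
  also have "\<dots> =  (x \<triangleright>\<^bsub>Q\<^esub> y) \<triangleright>\<^bsub>Q\<^esub> (x \<triangleright>\<^bsub>Q\<^esub> z)" using * by (elim mesh_carrierE) (simp only: mesh_medial)
  finally show "x \<triangleright>\<^bsub>Q\<^esub> (y \<triangleright>\<^bsub>Q\<^esub> z) = (x \<triangleright>\<^bsub>Q\<^esub> y) \<triangleright>\<^bsub>Q\<^esub> (x \<triangleright>\<^bsub>Q\<^esub> z)" .
qed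

lemma left_mult_mesh_Bij: "left_mult Q ` carrier Q \<subseteq> Bij (carrier Q)"
proof -
  interpret medial_quandle Q by (rule medial_quandle_mesh)
  show ?thesis using left_mult_Bij by auto
qed

abbreviation (input) "B \<equiv> BijGroup (carrier Q)"
abbreviation (input) "L \<equiv> generate B (left_mult Q ` carrier Q)"

lemma L_Bij: "f \<in> L \<Longrightarrow> f \<in> Bij (carrier Q)"
  using group.generate_in_carrier[OF group_BijGroup, of "left_mult Q ` carrier Q" "carrier Q" f] left_mult_mesh_Bij
  by (simp add: BijGroup_def)

lemma mult_B: "f \<in> Bij (carrier Q) \<Longrightarrow> g \<in> Bij (carrier Q) \<Longrightarrow> x \<in> carrier Q \<Longrightarrow> (f \<otimes>\<^bsub>B\<^esub> g) x = f (g x)"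
  by (simp add: BijGroup_def compose_def)

lemma L_fst: "f \<in> L \<Longrightarrow> x \<in> carrier Q \<Longrightarrow> fst (f x) = fst x"
proof (induction f arbitrary: x rule: generate.induct)
  case one then show ?case by (simp add: BijGroup_def)
next
  case (incl h) then show ?case by (auto simp: left_mult_def carrier_mesh op_mesh)
next
  case (inv h)
  then have h: "h \<in> Bij (carrier Q)" using left_mult_mesh_Bij by auto
  then have s: "h ` carrier Q = carrier Q" by (auto simp: Bij_def bij_betw_def)
  let ?y = "inv_into (carrier Q) h x"
  have y: "?y \<in> carrier Q" "h ?y = x" using s inv(2) by (auto intro: inv_into_into f_inv_into_f)
  have "fst (h ?y) = fst ?y" using inv(1) y(1) by (auto simp: left_mult_def carrier_mesh op_mesh)
  then show ?case using h y inv(2) by (simp add: inv_BijGroup)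
next
  case (eng h1 h2)
  then have "h1 \<in> Bij (carrier Q)" "h2 \<in> Bij (carrier Q)" using L_Bij by auto
  then show ?case using eng Bij_imp_funcset[of h2]
    by (auto simp: BijGroup_def compose_def Pi_iff)
qed

text \<open>The translations of \<open>A j\<close> that are induced by elements of the left multiplication group.\<close>

definition mesh_translations :: "'i \<Rightarrow> 'a set" where
  "mesh_translations j = {d \<in> carrier (A j). \<exists>f\<in>L. \<forall>b\<in>carrier (A j). f (j,b) = (j, d \<otimes>\<^bsub>A j\<^esub> b)}"

lemma trans_gen:
  assumes "i \<in> I" "j \<in> I" "a \<in> carrier (A i)"
  shows "c i j \<otimes>\<^bsub>A j\<^esub> \<phi> i j a \<in> mesh_translations j"
proof -
  interpret comm_group "A j" using comm_group assms by blast
  let ?p = "left_mult Q (i,a)" and ?q = "left_mult Q (j,\<one>\<^bsub>A j\<^esub>)"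
  have C: "(i,a) \<in> carrier Q" "(j,\<one>\<^bsub>A j\<^esub>) \<in> carrier Q" using assms by (auto simp: carrier_mesh)
  then have B: "?p \<in> Bij (carrier Q)" "?q \<in> Bij (carrier Q)" using left_mult_mesh_Bij by auto
  then have qi: "inv\<^bsub>B\<^esub> ?q \<in> Bij (carrier Q)" by (simp add: inv_BijGroup restrict_inv_into_Bij)
  have qs: "?q ` carrier Q = carrier Q" using B by (auto simp: Bij_def bij_betw_def)
  let ?f = "?p \<otimes>\<^bsub>B\<^esub> inv\<^bsub>B\<^esub> ?q"
  have "?f \<in> L" using C by (intro generate.eng generate.incl generate.inv) auto
  moreover have "?f (j,b) = (j, (c i j \<otimes>\<^bsub>A j\<^esub> \<phi> i j a) \<otimes>\<^bsub>A j\<^esub> b)" if b: "b \<in> carrier (A j)" for b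
  proof -
    have jb: "(j,b) \<in> carrier Q" using b assms by (auto simp: carrier_mesh)
    let ?y = "inv_into (carrier Q) ?q (j,b)"
    have y: "?y \<in> carrier Q" "?q ?y = (j,b)" using qs jb by (auto intro: inv_into_into f_inv_into_f)
    then obtain v where v: "?y = (j,v)" "v \<in> carrier (A j)"
      by (auto simp: left_mult_def carrier_mesh op_mesh)
    have "v \<otimes>\<^bsub>A j\<^esub> inv\<^bsub>A j\<^esub> \<phi> j j v = b"
      using y v assms by (simp add: left_mult_def op_mesh const_diag hom_one hom_closed)
    moreover have "?f (j,b) = ?p ?y"
      by (simp add: mult_B[OF B(1) qi jb]) (simp add: inv_BijGroup B jb)
    ultimately show ?thesis using y v by (simp add: left_mult_def op_mesh)
  qed
  moreover have "c i j \<otimes>\<^bsub>A j\<^esub> \<phi> i j a \<in> carrier (A j)" using assms by (simp add: const_closed hom_closed)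
  ultimately show ?thesis unfolding mesh_translations_def by blast
qed

lemma trans_mult:
  assumes "j \<in> I" "d \<in> mesh_translations j" "e \<in> mesh_translations j"
  shows "d \<otimes>\<^bsub>A j\<^esub> e \<in> mesh_translations j"
proof -
  interpret comm_group "A j" using comm_group assms by blast
  obtain f where f: "f \<in> L" "\<forall>b\<in>carrier (A j). f (j,b) = (j, d \<otimes>\<^bsub>A j\<^esub> b)" using assms by (auto simp: mesh_translations_def)
  obtain g where g: "g \<in> L" "\<forall>b\<in>carrier (A j). g (j,b) = (j, e \<otimes>\<^bsub>A j\<^esub> b)" using assms by (auto simp: mesh_translations_def)
  have de: "d \<in> carrier (A j)" "e \<in> carrier (A j)" using assms by (auto simp: mesh_translations_def)
  have "f \<otimes>\<^bsub>B\<^esub> g \<in> L" using f g by (intro generate.eng)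
  moreover have "(f \<otimes>\<^bsub>B\<^esub> g) (j,b) = (j, d \<otimes>\<^bsub>A j\<^esub> e \<otimes>\<^bsub>A j\<^esub> b)" if "b \<in> carrier (A j)" for b
    proof -
    have "(j,b) \<in> carrier Q" using that assms(1) by (simp add: carrier_mesh)
    then have "(f \<otimes>\<^bsub>B\<^esub> g) (j,b) = f (g (j,b))" using f g L_Bij by (intro mult_B)
    then show ?thesis using f g that de by (simp add: m_assoc)
  qed
  moreover have "d \<otimes>\<^bsub>A j\<^esub> e \<in> carrier (A j)" using de by simp
  ultimately show ?thesis unfolding mesh_translations_def by blast
qed

lemma trans_inv:
  assumes "j \<in> I" "d \<in> mesh_translations j"
  shows "inv\<^bsub>A j\<^esub> d \<in> mesh_translations j"
proof -
  interpret comm_group "A j" using comm_group assms by blast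
  obtain f where f: "f \<in> L" "\<forall>b\<in>carrier (A j). f (j,b) = (j, d \<otimes>\<^bsub>A j\<^esub> b)" using assms by (auto simp: mesh_translations_def)
  have d: "d \<in> carrier (A j)" using assms by (auto simp: mesh_translations_def)
  have fB: "f \<in> Bij (carrier Q)" using f L_Bij by auto
  have "inv\<^bsub>B\<^esub> f \<in> L" using f left_mult_mesh_Bij
    by (intro group.generate_m_inv_closed group_BijGroup) (auto simp: BijGroup_def)
  moreover have "(inv\<^bsub>B\<^esub> f) (j,b) = (j, inv\<^bsub>A j\<^esub> d \<otimes>\<^bsub>A j\<^esub> b)" if b: "b \<in> carrier (A j)" for b
  proof -
    have "f (j, inv\<^bsub>A j\<^esub> d \<otimes>\<^bsub>A j\<^esub> b) = (j,b)" using f b d by (simp add: m_assoc[symmetric])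
    moreover have "(j, inv\<^bsub>A j\<^esub> d \<otimes>\<^bsub>A j\<^esub> b) \<in> carrier Q" "(j,b) \<in> carrier Q" using b d assms(1) by (auto simp: carrier_mesh)
    moreover have "inj_on f (carrier Q)" using fB by (auto simp: Bij_def bij_betw_def)
    ultimately show ?thesis using fB by (simp add: inv_BijGroup inv_into_f_eq)
  qed
  moreover have "inv\<^bsub>A j\<^esub> d \<in> carrier (A j)" using d by simp
  ultimately show ?thesis unfolding mesh_translations_def by blast
qed

lemma mesh_translations_all:
  assumes "j \<in> I" shows "mesh_translations j = carrier (A j)"
proof -
  interpret comm_group "A j" using comm_group assms by blast
  have one: "\<one>\<^bsub>A j\<^esub> \<in> mesh_translations j" using trans_gen[OF assms assms one_closed] hom_one[OF assms assms] const_diag[OF assms] by (simp add: const_diag hom_one)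
  have cc: "c i j \<in> mesh_translations j" if "i \<in> I" for i
    using trans_gen[OF that assms monoid.one_closed] that assms
    by (simp add: hom_one const_closed group.is_monoid grp)
  have ph: "\<phi> i j a \<in> mesh_translations j" if "i \<in> I" "a \<in> carrier (A i)" for i a
  proof -
    have "inv\<^bsub>A j\<^esub> c i j \<otimes>\<^bsub>A j\<^esub> (c i j \<otimes>\<^bsub>A j\<^esub> \<phi> i j a) \<in> mesh_translations j"
      using that assms by (intro trans_mult trans_inv trans_gen cc)
    then show ?thesis using that assms by (simp add: m_assoc[symmetric] const_closed hom_closed)
  qed
  have "x \<in> mesh_translations j" if "x \<in> generate (A j) ({c i j | i. i \<in> I} \<union> {\<phi> i j a | i a. i \<in> I \<and> a \<in> carrier (A i)})" for x
    using that
  proof (induction rule: generate.induct)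
    case one then show ?case by (rule \<open>\<one>\<^bsub>A j\<^esub> \<in> mesh_translations j\<close>)
  next
    case (incl h) then show ?case using cc ph by blast
  next
    case (inv h) then have "h \<in> mesh_translations j" using cc ph by blast
    then show ?case by (rule trans_inv[OF assms])
  next
    case (eng h1 h2) then show ?case using trans_mult[OF assms] by blast
  qed
  then show ?thesis using generated[OF assms] by (auto simp: mesh_translations_def)
qed

lemma orbit_mesh:
  assumes "j \<in> I" "b \<in> carrier (A j)"
  shows "orbit (left_mult_group Q) (\<lambda>f. f) (j,b) = mesh_component A j"
proof -
  interpret comm_group "A j" using comm_group assms by blast
  have 1: "f (j,b) \<in> {j} \<times> carrier (A j)" if "f \<in> L" for f
  proof -
    have jb: "(j,b) \<in> carrier Q" using assms by (auto simp: carrier_mesh)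
    have "f (j,b) \<in> carrier Q" using L_Bij[OF that] jb Bij_imp_funcset by fastforce
    then show ?thesis using L_fst[OF that jb] by (auto simp: carrier_mesh)
  qed
  have 2: "\<exists>f\<in>L. f (j,b) = (j,x)" if "x \<in> carrier (A j)" for x
  proof -
    have "x \<otimes>\<^bsub>A j\<^esub> inv\<^bsub>A j\<^esub> b \<in> mesh_translations j" using that assms mesh_translations_all by simp
    then obtain f where "f \<in> L" "f (j,b) = (j, x \<otimes>\<^bsub>A j\<^esub> inv\<^bsub>A j\<^esub> b \<otimes>\<^bsub>A j\<^esub> b)"
      using assms by (auto simp: mesh_translations_def)
    then show ?thesis using that assms by (auto simp: m_assoc)
  qed
  show ?thesis unfolding orbit_def left_mult_group_def mesh_component_def
  proof (intro equalityI subsetI)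
    fix x assume "x \<in> {f (j,b) |f. f \<in> carrier (B\<lparr>carrier := L\<rparr>)}"
    then show "x \<in> {j} \<times> carrier (A j)" using 1 by auto
  next
    fix x assume "x \<in> {j} \<times> carrier (A j)"
    then obtain y where "x = (j,y)" "y \<in> carrier (A j)" by auto
    moreover then obtain f where "f \<in> L" "f (j,b) = (j,y)" using 2 by blast
    ultimately show "x \<in> {f (j,b) |f. f \<in> carrier (B\<lparr>carrier := L\<rparr>)}" by (auto intro!: exI[of _ f])
  qed
qed

theorem components_mesh: "components Q = mesh_component A ` I"
proof
  show "components Q \<subseteq> mesh_component A ` I"
    unfolding components_def orbits_def by (auto simp: carrier_mesh orbit_mesh)
  show "mesh_component A ` I \<subseteq> components Q"
  proof
    fix C assume "C \<in> mesh_component A ` I"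
    then obtain i where i: "i \<in> I" "C = mesh_component A i" by auto
    then have o: "\<one>\<^bsub>A i\<^esub> \<in> carrier (A i)" using grp by (simp add: group.is_monoid monoid.one_closed)
    have "C = orbit (left_mult_group Q) (\<lambda>f. f) (i, \<one>\<^bsub>A i\<^esub>)" using i o orbit_mesh by simp
    moreover have "(i, \<one>\<^bsub>A i\<^esub>) \<in> carrier Q" using i o by (auto simp: carrier_mesh)
    ultimately show "C \<in> components Q" unfolding components_def orbits_def by blast
  qed
qed

end

end

theory Submission
  imports Defs
begin

text \<open>
  A homomorphism \<open>h\<close> inducing \<open>g\<close> has the form \<open>h (i, a) = (g i, F i a)\<close>; put \<open>e i = F i 0\<close> and
  \<open>k i a = F i a - e i\<close>. Since \<open>1 - \<sigma> j j\<close> is onto, the homomorphism equation says that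
  \<open>F j (x + b) = k j x + F j b\<close> for all \<open>b\<close> whenever \<open>x = s i j + \<sigma> i j a\<close>, and it determines
  \<open>k j x\<close> for these \<open>x\<close>. They generate \<open>S j\<close>, hence \<open>k j\<close> is additive, and (i) and (ii) are
  the values of \<open>k j\<close> at \<open>\<sigma> i j a\<close> and \<open>s i j\<close>. Conversely, \<open>h (i, a) = (g i, e i + k i a)\<close> is a
  homomorphism by direct computation.
\<close>

section \<open>Subgroups of elements satisfying a functional equation\<close>

text \<open>This reduces additivity of \<open>k\<close> to left summands from a generating set, with
  the right summand still arbitrary. The normalization of \<open>k\<close> at the neutral element
  puts that element into the set and later identifies the value of \<open>k\<close> at an
  inverse.\<close>

lemma subgroup_additive_elements:
  assumes "group G" "group H" and k: "k \<in> carrier G \<rightarrow> carrier H" "k \<one>\<^bsub>G\<^esub> = \<one>\<^bsub>H\<^esub>"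
  shows "subgroup {x \<in> carrier G. \<forall>b\<in>carrier G. k (x \<otimes>\<^bsub>G\<^esub> b) = k x \<otimes>\<^bsub>H\<^esub> k b} G"
proof -
  interpret G: group G by fact
  interpret H: group H by fact
  have kc: "k x \<in> carrier H" if "x \<in> carrier G" for x using k that by auto
  show ?thesis
  proof (rule G.subgroupI)
    show "{x \<in> carrier G. \<forall>b\<in>carrier G. k (x \<otimes>\<^bsub>G\<^esub> b) = k x \<otimes>\<^bsub>H\<^esub> k b} \<noteq> {}"
      using k kc by (auto intro!: exI[of _ "\<one>\<^bsub>G\<^esub>"])
  next
    fix x assume "x \<in> {x \<in> carrier G. \<forall>b\<in>carrier G. k (x \<otimes>\<^bsub>G\<^esub> b) = k x \<otimes>\<^bsub>H\<^esub> k b}"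
    then have x: "x \<in> carrier G" and add: "\<And>b. b \<in> carrier G \<Longrightarrow> k (x \<otimes>\<^bsub>G\<^esub> b) = k x \<otimes>\<^bsub>H\<^esub> k b"
      by auto
    have *: "k (inv\<^bsub>G\<^esub> x \<otimes>\<^bsub>G\<^esub> b) = inv\<^bsub>H\<^esub> k x \<otimes>\<^bsub>H\<^esub> k b" if b: "b \<in> carrier G" for b
    proof -
      \<comment> \<open>The equation for \<open>x\<close> is applied to the right factor
        \<open>inv x \<otimes> b\<close>.\<close>
      have "k b = k x \<otimes>\<^bsub>H\<^esub> k (inv\<^bsub>G\<^esub> x \<otimes>\<^bsub>G\<^esub> b)"
        using add[of "inv\<^bsub>G\<^esub> x \<otimes>\<^bsub>G\<^esub> b"] x b by (simp add: G.m_assoc[symmetric])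
      then show ?thesis using x b kc by (simp add: H.m_assoc[symmetric])
    qed
    \<comment> \<open>With \<open>b\<close> neutral, the factor \<open>inv (k x)\<close> in
      \<open>*\<close> turns out to be \<open>k (inv x)\<close>, so \<open>*\<close> becomes the
      equation required of \<open>inv x\<close>.\<close>
    have "k (inv\<^bsub>G\<^esub> x) = inv\<^bsub>H\<^esub> k x" using *[of "\<one>\<^bsub>G\<^esub>"] x k kc by simp
    then show "inv\<^bsub>G\<^esub> x \<in> {x \<in> carrier G. \<forall>b\<in>carrier G. k (x \<otimes>\<^bsub>G\<^esub> b) = k x \<otimes>\<^bsub>H\<^esub> k b}"
      using x * by simp
  next
    fix x y
    assume "x \<in> {x \<in> carrier G. \<forall>b\<in>carrier G. k (x \<otimes>\<^bsub>G\<^esub> b) = k x \<otimes>\<^bsub>H\<^esub> k b}"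
      and "y \<in> {x \<in> carrier G. \<forall>b\<in>carrier G. k (x \<otimes>\<^bsub>G\<^esub> b) = k x \<otimes>\<^bsub>H\<^esub> k b}"
    then show "x \<otimes>\<^bsub>G\<^esub> y \<in> {x \<in> carrier G. \<forall>b\<in>carrier G. k (x \<otimes>\<^bsub>G\<^esub> b) = k x \<otimes>\<^bsub>H\<^esub> k b}"
      by (auto simp: G.m_assoc H.m_assoc kc)
  qed auto
qed

text \<open>If all generators are periods of \<open>f\<close>, then every element is one and
  \<open>f\<close> is constant. This is how homomorphisms are shown to respect components.\<close>

lemma (in group) subgroup_periods:
  "subgroup {x \<in> carrier G. \<forall>b\<in>carrier G. f (x \<otimes> b) = f b} G"
proof (rule subgroupI)
  show "{x \<in> carrier G. \<forall>b\<in>carrier G. f (x \<otimes> b) = f b} \<noteq> {}"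
    by (auto intro!: exI[of _ \<one>])
next
  fix x assume "x \<in> {x \<in> carrier G. \<forall>b\<in>carrier G. f (x \<otimes> b) = f b}"
  then have x: "x \<in> carrier G" and per: "\<And>b. b \<in> carrier G \<Longrightarrow> f (x \<otimes> b) = f b" by auto
  have "f (inv x \<otimes> b) = f b" if "b \<in> carrier G" for b
    using per[of "inv x \<otimes> b"] x that by (simp add: m_assoc[symmetric])
  with x show "inv x \<in> {x \<in> carrier G. \<forall>b\<in>carrier G. f (x \<otimes> b) = f b}" by simp
qed (auto simp: m_assoc)

section \<open>Generators of the groups of a single mesh\<close>

context ia_mesh begin

lemma one_minus_surj:
  assumes "j \<in> I" "y \<in> carrier (A j)"
  obtains b where "b \<in> carrier (A j)" "b \<otimes>\<^bsub>A j\<^esub> inv\<^bsub>A j\<^esub> (\<phi> j j b) = y"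
  using one_minus_iso[OF assms(1)] assms(2) by (force simp: iso_def bij_betw_def)

text \<open>The elements in \<open>gen\<close> are the offsets by which \<open>(i, a)\<close> acts
  on component \<open>j\<close>. Taking \<open>a\<close> to be zero yields \<open>c i j\<close>, and
  subtracting it yields \<open>\<phi> i j a\<close>; together these are the generators of axiom
  (5).\<close>

lemma subgroup_eq_carrier:
  assumes j: "j \<in> I" and sub: "subgroup H (A j)"
    and gen: "\<And>i a. i \<in> I \<Longrightarrow> a \<in> carrier (A i) \<Longrightarrow> c i j \<otimes>\<^bsub>A j\<^esub> \<phi> i j a \<in> H"
  shows "H = carrier (A j)"
proof
  interpret comm_group "A j" using comm_group j by blast
  show "H \<subseteq> carrier (A j)" using sub by (rule subgroup.subset)
  have c: "c i j \<in> H" if "i \<in> I" for i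
    using gen[OF that group.subgroup_self[THEN subgroup.one_closed]] that j
    by (simp add: grp hom_one const_closed)
  have \<phi>: "\<phi> i j a \<in> H" if "i \<in> I" "a \<in> carrier (A i)" for i a
  proof -
    have "inv\<^bsub>A j\<^esub> c i j \<otimes>\<^bsub>A j\<^esub> (c i j \<otimes>\<^bsub>A j\<^esub> \<phi> i j a) \<in> H"
      by (rule subgroup.m_closed[OF sub subgroup.m_inv_closed[OF sub c[OF that(1)]] gen[OF that]])
    then show ?thesis using that j by (simp add: m_assoc[symmetric] const_closed hom_closed)
  qed
  have "generate (A j) ({c i j | i. i \<in> I} \<union> {\<phi> i j a | i a. i \<in> I \<and> a \<in> carrier (A i)}) \<subseteq> H"
    using c \<phi> by (intro generate_subgroup_incl[OF _ sub]) auto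
  then show "carrier (A j) \<subseteq> H" using generated[OF j] by simp
qed

text \<open>Each offset \<open>c i j + \<phi> i j a\<close> is a period of \<open>f\<close> on
  component \<open>j\<close>, since \<open>b\<close> and its translate by the offset are both left
  multiples of one element \<open>(j, v)\<close>. The offsets generate \<open>A j\<close>, so every
  element is a period.\<close>

lemma left_invariant_constant:
  assumes inv: "\<And>x y. x \<in> carrier Q \<Longrightarrow> y \<in> carrier Q \<Longrightarrow> f (x \<triangleright>\<^bsub>Q\<^esub> y) = f y"
    and j: "j \<in> I" and ab: "a \<in> carrier (A j)" "b \<in> carrier (A j)"
  shows "f (j, a) = f (j, b)"
proof -
  interpret comm_group "A j" using comm_group j by blast
  let ?H = "{x \<in> carrier (A j). \<forall>b\<in>carrier (A j). f (j, x \<otimes>\<^bsub>A j\<^esub> b) = f (j, b)}"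
  have H: "?H = carrier (A j)"
  proof (rule subgroup_eq_carrier[OF j subgroup_periods])
    fix i a assume i: "i \<in> I" "a \<in> carrier (A i)"
    have "f (j, c i j \<otimes>\<^bsub>A j\<^esub> \<phi> i j a \<otimes>\<^bsub>A j\<^esub> b) = f (j, b)" if b: "b \<in> carrier (A j)" for b
    proof -
      \<comment> \<open>With \<open>v\<close> the preimage of \<open>b\<close> under
        \<open>1 - \<phi> j j\<close>, acting on \<open>(j, v)\<close> by \<open>(i, a)\<close>
        gives the translate of \<open>b\<close>, and acting by \<open>(j, 0)\<close> gives
        \<open>b\<close> itself.\<close>
      obtain v where v: "v \<in> carrier (A j)" "v \<otimes>\<^bsub>A j\<^esub> inv\<^bsub>A j\<^esub> (\<phi> j j v) = b"
        using one_minus_surj[OF j b] .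
      have "f (j, c i j \<otimes>\<^bsub>A j\<^esub> \<phi> i j a \<otimes>\<^bsub>A j\<^esub> b) = f (j, v)"
        using inv[of "(i, a)" "(j, v)"] i j v by (simp add: carrier_mesh op_mesh)
      moreover have "f (j, b) = f (j, v)"
        using inv[of "(j, \<one>\<^bsub>A j\<^esub>)" "(j, v)"] j v b
        by (simp add: carrier_mesh op_mesh const_diag hom_one)
      ultimately show ?thesis by simp
    qed
    then show "c i j \<otimes>\<^bsub>A j\<^esub> \<phi> i j a \<in> ?H" using i j by (simp add: const_closed hom_closed)
  qed
  have "f (j, x) = f (j, \<one>\<^bsub>A j\<^esub>)" if "x \<in> carrier (A j)" for x
  proof -
    have "x \<in> ?H" using that H by simp
    then have "f (j, x \<otimes>\<^bsub>A j\<^esub> \<one>\<^bsub>A j\<^esub>) = f (j, \<one>\<^bsub>A j\<^esub>)" by blast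
    then show ?thesis using that by simp
  qed
  then show ?thesis using ab by metis
qed

end

section \<open>The induced map on components for two meshes\<close>

locale mesh_pair = S: ia_mesh I S \<sigma> s + T: ia_mesh J T \<tau> t
  for I :: "'i set" and S :: "'i \<Rightarrow> ('a, 'm) monoid_scheme" and \<sigma> s
    and J :: "'j set" and T :: "'j \<Rightarrow> ('b, 'n) monoid_scheme" and \<tau> t
begin

abbreviation (input) "QS \<equiv> mesh_quandle I S \<sigma> s"
abbreviation (input) "QT \<equiv> mesh_quandle J T \<tau> t"

lemma one_in_S: "i \<in> I \<Longrightarrow> \<one>\<^bsub>S i\<^esub> \<in> carrier (S i)"
  by (simp add: S.grp group.is_monoid)

text \<open>The definite description is unique because components carry their index as first
  coordinate, so different ones are disjoint, while the image is nonempty: it contains the value at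
  \<open>(i, 0)\<close>.\<close>

lemma component_map_eqI:
  assumes "i \<in> I" "j \<in> J" and sub: "h ` mesh_component S i \<subseteq> mesh_component T j"
  shows "component_map QT h (mesh_component S i) = mesh_component T j"
  unfolding component_map_def
proof (rule the_equality)
  show "mesh_component T j \<in> components QT \<and> h ` mesh_component S i \<subseteq> mesh_component T j"
    using assms by (auto simp: T.components_mesh)
next
  fix D assume D: "D \<in> components QT \<and> h ` mesh_component S i \<subseteq> D"
  then obtain j' where j': "D = mesh_component T j'" by (auto simp: T.components_mesh)
  have "(i, \<one>\<^bsub>S i\<^esub>) \<in> mesh_component S i"
    using one_in_S[OF assms(1)] by (simp add: mesh_component_def)
  then have "h (i, \<one>\<^bsub>S i\<^esub>) \<in> D" "h (i, \<one>\<^bsub>S i\<^esub>) \<in> mesh_component T j" using D sub by auto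
  then show "D = mesh_component T j" using j' by (auto simp: mesh_component_def)
qed

text \<open>A product in a mesh quandle lies in the component of its right factor. Hence
  \<open>fst\<close> composed with \<open>h\<close> is invariant under left multiplications, and
  \<open>left_invariant_constant\<close> applies.\<close>

lemma hom_image_component:
  assumes h: "h \<in> quandle_hom QS QT" and i: "i \<in> I"
  obtains j where "j \<in> J" "h ` mesh_component S i \<subseteq> mesh_component T j"
proof -
  have hc: "h x \<in> carrier QT" if "x \<in> carrier QS" for x
    using h that by (auto simp: quandle_hom_def)
  have inv: "fst (h (x \<triangleright>\<^bsub>QS\<^esub> y)) = fst (h y)" if "x \<in> carrier QS" "y \<in> carrier QS" for x y
  proof -
    have "h (x \<triangleright>\<^bsub>QS\<^esub> y) = h x \<triangleright>\<^bsub>QT\<^esub> h y" using h that by (simp add: quandle_hom_def)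
    also have "fst \<dots> = fst (h y)" by (cases "h x"; cases "h y") (simp add: T.op_mesh)
    finally show ?thesis .
  qed
  let ?j = "fst (h (i, \<one>\<^bsub>S i\<^esub>))"
  have "h (i, a) \<in> mesh_component T ?j" if a: "a \<in> carrier (S i)" for a
  proof -
    have "fst (h (i, a)) = ?j"
      using S.left_invariant_constant[of "\<lambda>x. fst (h x)", OF inv i a one_in_S[OF i]] .
    moreover have "h (i, a) \<in> carrier QT" using hc i a by (simp add: S.carrier_mesh)
    ultimately show ?thesis by (auto simp: T.carrier_mesh mesh_component_def)
  qed
  moreover have "?j \<in> J"
    using hc[of "(i, \<one>\<^bsub>S i\<^esub>)"] i one_in_S by (auto simp: S.carrier_mesh T.carrier_mesh)
  ultimately show thesis using that[of ?j] by (auto simp: mesh_component_def)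
qed

text \<open>An equation about a definite description says something about \<open>h\<close> only once
  a component containing the image is known to exist. \<open>hom_image_component\<close> supplies
  one, and \<open>component_map_eqI\<close> identifies it.\<close>

lemma component_map_eqD:
  assumes h: "h \<in> quandle_hom QS QT" and "i \<in> I" "j \<in> J"
    and eq: "component_map QT h (mesh_component S i) = mesh_component T j"
  shows "h ` mesh_component S i \<subseteq> mesh_component T j"
  using hom_image_component[OF h \<open>i \<in> I\<close>] component_map_eqI[OF \<open>i \<in> I\<close>, of _ h] eq by metis

section \<open>Homomorphisms and families of affine maps\<close>

text \<open>After expansion both sides of the homomorphism equation are the same sum in
  \<open>T (g j)\<close>: \<open>k\<sigma>\<close> matches the terms containing \<open>a\<close> and
  \<open>b\<close>, and \<open>ks\<close> contributes exactly the images of \<open>e i\<close> and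
  \<open>e j\<close> under \<open>\<tau>\<close>.\<close>

lemma affine_family_imp_hom:
  assumes g: "g \<in> I \<rightarrow> J"
    and k: "\<And>i. i \<in> I \<Longrightarrow> k i \<in> hom (S i) (T (g i))"
    and e: "\<And>i. i \<in> I \<Longrightarrow> e i \<in> carrier (T (g i))"
    and k\<sigma>: "\<And>i j a. i \<in> I \<Longrightarrow> j \<in> I \<Longrightarrow> a \<in> carrier (S i) \<Longrightarrow>
      k j (\<sigma> i j a) = \<tau> (g i) (g j) (k i a)"
    and ks: "\<And>i j. i \<in> I \<Longrightarrow> j \<in> I \<Longrightarrow>
      k j (s i j) = t (g i) (g j) \<otimes>\<^bsub>T (g j)\<^esub> \<tau> (g i) (g j) (e i)
        \<otimes>\<^bsub>T (g j)\<^esub> inv\<^bsub>T (g j)\<^esub> (\<tau> (g j) (g j) (e j))"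
  shows "(\<lambda>(i, a). (g i, e i \<otimes>\<^bsub>T (g i)\<^esub> k i a)) \<in> quandle_hom QS QT"
proof -
  let ?h = "\<lambda>(i, a). (g i, e i \<otimes>\<^bsub>T (g i)\<^esub> k i a)"
  have gJ: "g i \<in> J" if "i \<in> I" for i using g that by auto
  have kc: "k i a \<in> carrier (T (g i))" if "i \<in> I" "a \<in> carrier (S i)" for i a
    using k[OF that(1)] that(2) by (auto simp: hom_def)
  have hom_eq: "?h ((i, a) \<triangleright>\<^bsub>QS\<^esub> (j, b)) = ?h (i, a) \<triangleright>\<^bsub>QT\<^esub> ?h (j, b)"
    if ij: "i \<in> I" "j \<in> I" and ab: "a \<in> carrier (S i)" "b \<in> carrier (S j)" for i j a b
  proof -
    interpret Sj: comm_group "S j" using S.comm_group ij by blast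
    interpret Tj: comm_group "T (g j)" using T.comm_group gJ ij by blast
    interpret Ti: comm_group "T (g i)" using T.comm_group gJ ij by blast
    interpret kj: group_hom "S j" "T (g j)" "k j"
      using k ij by (simp add: group_hom_def group_hom_axioms_def Sj.is_group Tj.is_group)
    note [simp] = ij ab S.const_closed S.hom_closed gJ kc e T.const_closed T.hom_closed
      T.hom_mult k\<sigma> ks Tj.inv_mult
    show ?thesis
      by (simp add: S.op_mesh T.op_mesh Tj.m_ac)
  qed
  have "?h x \<in> carrier QT" if "x \<in> carrier QS" for x
    using that gJ e kc
    by (auto simp: S.carrier_mesh T.carrier_mesh intro!: monoid.m_closed group.is_monoid T.grp)
  then show ?thesis
    unfolding quandle_hom_def using hom_eq by (auto simp: S.carrier_mesh)
qed

text \<open>Here \<open>F\<close> stands for the second coordinate of a homomorphism, and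
  \<open>hom_eq\<close> is the homomorphism equation in that coordinate. Subtracting
  \<open>e\<close> makes \<open>k j\<close> vanish at zero, as
  \<open>subgroup_additive_elements\<close> requires.\<close>

lemma hom_imp_affine_family:
  assumes g: "g \<in> I \<rightarrow> J"
    and F: "\<And>i a. i \<in> I \<Longrightarrow> a \<in> carrier (S i) \<Longrightarrow> F i a \<in> carrier (T (g i))"
    and hom_eq: "\<And>i j a b. i \<in> I \<Longrightarrow> j \<in> I \<Longrightarrow> a \<in> carrier (S i) \<Longrightarrow> b \<in> carrier (S j) \<Longrightarrow>
      F j (s i j \<otimes>\<^bsub>S j\<^esub> \<sigma> i j a \<otimes>\<^bsub>S j\<^esub> (b \<otimes>\<^bsub>S j\<^esub> inv\<^bsub>S j\<^esub> (\<sigma> j j b))) =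
      t (g i) (g j) \<otimes>\<^bsub>T (g j)\<^esub> \<tau> (g i) (g j) (F i a)
        \<otimes>\<^bsub>T (g j)\<^esub> (F j b \<otimes>\<^bsub>T (g j)\<^esub> inv\<^bsub>T (g j)\<^esub> (\<tau> (g j) (g j) (F j b)))"
  defines "e \<equiv> \<lambda>i. F i \<one>\<^bsub>S i\<^esub>"
  defines "k \<equiv> \<lambda>i a. F i a \<otimes>\<^bsub>T (g i)\<^esub> inv\<^bsub>T (g i)\<^esub> (e i)"
  assumes ij: "i \<in> I" "j \<in> I"
  shows "k j \<in> hom (S j) (T (g j))"
    and "a \<in> carrier (S i) \<Longrightarrow> k j (\<sigma> i j a) = \<tau> (g i) (g j) (k i a)"
    and "k j (s i j) = t (g i) (g j) \<otimes>\<^bsub>T (g j)\<^esub> \<tau> (g i) (g j) (e i)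
        \<otimes>\<^bsub>T (g j)\<^esub> inv\<^bsub>T (g j)\<^esub> (\<tau> (g j) (g j) (e j))"
proof -
  have gJ [simp]: "g i \<in> J" if "i \<in> I" for i using g that by auto
  interpret Sj: comm_group "S j" using S.comm_group ij by blast
  interpret Tj: comm_group "T (g j)" using T.comm_group gJ ij by blast
  interpret Ti: comm_group "T (g i)" using T.comm_group gJ ij by blast
  note [simp] = F S.const_closed S.hom_closed one_in_S T.const_closed T.hom_closed
  have [simp]: "e i \<in> carrier (T (g i))" if "i \<in> I" for i using that by (simp add: e_def)
  have kc: "k j x \<in> carrier (T (g j))" if "x \<in> carrier (S j)" for x
    using that ij by (simp add: k_def)
  \<comment> \<open>This is the difference of \<open>hom_eq\<close> for \<open>(i, a)\<close> and
    for \<open>(j, 0)\<close> acting on the same element; the terms in \<open>F j v\<close> cancel.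
    It will be the value of \<open>k j\<close> at \<open>s i j + \<sigma> i j a\<close>.\<close>
  let ?u = "\<lambda>i a. t (g i) (g j) \<otimes>\<^bsub>T (g j)\<^esub> \<tau> (g i) (g j) (F i a)
        \<otimes>\<^bsub>T (g j)\<^esub> inv\<^bsub>T (g j)\<^esub> (\<tau> (g j) (g j) (e j))"
  have F_shift: "F j (s i j \<otimes>\<^bsub>S j\<^esub> \<sigma> i j a \<otimes>\<^bsub>S j\<^esub> b) = ?u i a \<otimes>\<^bsub>T (g j)\<^esub> F j b"
    if i: "i \<in> I" "a \<in> carrier (S i)" and b: "b \<in> carrier (S j)" for i a b
  proof -
    obtain v where v: "v \<in> carrier (S j)" "v \<otimes>\<^bsub>S j\<^esub> inv\<^bsub>S j\<^esub> (\<sigma> j j v) = b"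
      using S.one_minus_surj[OF ij(2) b] .
    let ?w = "F j v \<otimes>\<^bsub>T (g j)\<^esub> inv\<^bsub>T (g j)\<^esub> (\<tau> (g j) (g j) (F j v))"
    have w: "?w \<in> carrier (T (g j))" using ij v by simp
    \<comment> \<open>In the instance for \<open>(j, 0)\<close> the constants \<open>s j j\<close>
      and \<open>t (g j) (g j)\<close> and the image of zero under \<open>\<sigma> j j\<close> all
      vanish.\<close>
    have "F j b = \<tau> (g j) (g j) (e j) \<otimes>\<^bsub>T (g j)\<^esub> ?w"
      using hom_eq[of j j "\<one>\<^bsub>S j\<^esub>" v] ij v b
      by (simp add: S.const_diag T.const_diag S.hom_one e_def)
    then have "?u i a \<otimes>\<^bsub>T (g j)\<^esub> F j b
        = t (g i) (g j) \<otimes>\<^bsub>T (g j)\<^esub> \<tau> (g i) (g j) (F i a) \<otimes>\<^bsub>T (g j)\<^esub> ?w"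
      using ij i w by (simp add: Tj.m_assoc Tj.inv_solve_left del: Tj.inv_mult_group)
        (simp add: Tj.m_assoc[symmetric])
    then show ?thesis using hom_eq[OF i(1) ij(2) i(2) v(1)] v by simp
  qed
  \<comment> \<open>At \<open>b\<close> zero the last term of \<open>F_shift\<close> is
    \<open>e j\<close>, which the definition of \<open>k\<close> subtracts again.\<close>
  have k_gen: "k j (s i j \<otimes>\<^bsub>S j\<^esub> \<sigma> i j a) = ?u i a" if i: "i \<in> I" "a \<in> carrier (S i)" for i a
    using F_shift[OF i Sj.one_closed] i ij by (simp add: k_def Tj.m_assoc e_def)
  let ?H = "{x \<in> carrier (S j). \<forall>b\<in>carrier (S j). k j (x \<otimes>\<^bsub>S j\<^esub> b) = k j x \<otimes>\<^bsub>T (g j)\<^esub> k j b}"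
  have "?H = carrier (S j)"
  proof (rule S.subgroup_eq_carrier[OF ij(2)])
    show "subgroup ?H (S j)"
      using kc ij
      by (intro subgroup_additive_elements Sj.is_group Tj.is_group) (auto simp: k_def e_def)
    fix i a assume i: "i \<in> I" "a \<in> carrier (S i)"
    \<comment> \<open>\<open>k_gen\<close> identifies the first summand on the right with
      \<open>?u i a\<close>; subtracting \<open>e j\<close> from \<open>F_shift\<close> does the
      rest.\<close>
    have "k j (s i j \<otimes>\<^bsub>S j\<^esub> \<sigma> i j a \<otimes>\<^bsub>S j\<^esub> b) = k j (s i j \<otimes>\<^bsub>S j\<^esub> \<sigma> i j a) \<otimes>\<^bsub>T (g j)\<^esub> k j b"
      if "b \<in> carrier (S j)" for b
      unfolding k_gen[OF i] using that i ij by (simp add: k_def F_shift Tj.m_assoc)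
    then show "s i j \<otimes>\<^bsub>S j\<^esub> \<sigma> i j a \<in> ?H" using i ij by simp
  qed
  then have k_add: "k j (x \<otimes>\<^bsub>S j\<^esub> b) = k j x \<otimes>\<^bsub>T (g j)\<^esub> k j b"
    if "x \<in> carrier (S j)" "b \<in> carrier (S j)" for x b
    using that by blast
  show "k j \<in> hom (S j) (T (g j))" using k_add kc by (simp add: hom_def)
  show ks: "k j (s i j) = t (g i) (g j) \<otimes>\<^bsub>T (g j)\<^esub> \<tau> (g i) (g j) (e i)
      \<otimes>\<^bsub>T (g j)\<^esub> inv\<^bsub>T (g j)\<^esub> (\<tau> (g j) (g j) (e j))"
    using k_gen[of i "\<one>\<^bsub>S i\<^esub>"] ij by (simp add: S.hom_one e_def)
  show "k j (\<sigma> i j a) = \<tau> (g i) (g j) (k i a)" if a: "a \<in> carrier (S i)"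
  proof -
    \<comment> \<open>The value of \<open>k j\<close> at \<open>s i j + \<sigma> i j a\<close> is
      computed twice, by additivity and by \<open>k_gen\<close>, so that \<open>k j (s i j)\<close>
      can be cancelled.\<close>
    have "k j (s i j) \<otimes>\<^bsub>T (g j)\<^esub> k j (\<sigma> i j a) = ?u i a"
      using k_add[of "s i j" "\<sigma> i j a"] k_gen[OF ij(1) a] a ij by simp
    also have "\<dots> = k j (s i j) \<otimes>\<^bsub>T (g j)\<^esub> \<tau> (g i) (g j) (k i a)"
    proof -
      \<comment> \<open>Replacing \<open>x\<close> by \<open>y\<close> costs the difference of the
        two. For the images of \<open>F i a\<close> and \<open>e i\<close> this difference is the
        image of \<open>k i a\<close>.\<close>
      have cancel: "p \<otimes>\<^bsub>T (g j)\<^esub> x \<otimes>\<^bsub>T (g j)\<^esub> q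
          = p \<otimes>\<^bsub>T (g j)\<^esub> y \<otimes>\<^bsub>T (g j)\<^esub> q \<otimes>\<^bsub>T (g j)\<^esub> (x \<otimes>\<^bsub>T (g j)\<^esub> inv\<^bsub>T (g j)\<^esub> y)"
        if "p \<in> carrier (T (g j))" "q \<in> carrier (T (g j))" "x \<in> carrier (T (g j))"
          "y \<in> carrier (T (g j))" for p q x y
      proof -
        have "p \<otimes>\<^bsub>T (g j)\<^esub> y \<otimes>\<^bsub>T (g j)\<^esub> q \<otimes>\<^bsub>T (g j)\<^esub> (x \<otimes>\<^bsub>T (g j)\<^esub> inv\<^bsub>T (g j)\<^esub> y)
            = p \<otimes>\<^bsub>T (g j)\<^esub> x \<otimes>\<^bsub>T (g j)\<^esub> q \<otimes>\<^bsub>T (g j)\<^esub> (y \<otimes>\<^bsub>T (g j)\<^esub> inv\<^bsub>T (g j)\<^esub> y)"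
          using that by (simp add: Tj.m_ac del: Tj.r_inv)
        then show ?thesis using that by simp
      qed
      show ?thesis
        unfolding ks using a ij by (subst cancel[of _ _ _ "\<tau> (g i) (g j) (e i)"])
          (simp_all add: k_def T.hom_mult T.hom_inv)
    qed
    finally show ?thesis using a ij kc by (simp add: k_def)
  qed
qed

end

theorem theorem3p14:
  fixes I :: "'i set" and S :: "'i \<Rightarrow> ('a, 'm) monoid_scheme"
    and \<sigma> :: "'i \<Rightarrow> 'i \<Rightarrow> 'a \<Rightarrow> 'a" and s :: "'i \<Rightarrow> 'i \<Rightarrow> 'a"
    and J :: "'j set" and T :: "'j \<Rightarrow> ('b, 'n) monoid_scheme"
    and \<tau> :: "'j \<Rightarrow> 'j \<Rightarrow> 'b \<Rightarrow> 'b" and t :: "'j \<Rightarrow> 'j \<Rightarrow> 'b"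
    and g :: "'i \<Rightarrow> 'j"
  assumes "ia_mesh I S \<sigma> s" and "ia_mesh J T \<tau> t" and "g \<in> I \<rightarrow> J"
  shows "(\<exists>h \<in> quandle_hom (mesh_quandle I S \<sigma> s) (mesh_quandle J T \<tau> t).
           \<forall>i\<in>I. component_map (mesh_quandle J T \<tau> t) h (mesh_component S i)
                  = mesh_component T (g i))
     \<longleftrightarrow>
         (\<exists>k e. (\<forall>i\<in>I. k i \<in> hom (S i) (T (g i)) \<and> e i \<in> carrier (T (g i))) \<and>
           (\<forall>i\<in>I. \<forall>j\<in>I.
              (\<forall>a\<in>carrier (S i). k j (\<sigma> i j a) = \<tau> (g i) (g j) (k i a)) \<and>
              k j (s i j) = t (g i) (g j) \<otimes>\<^bsub>T (g j)\<^esub> \<tau> (g i) (g j) (e i)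
                              \<otimes>\<^bsub>T (g j)\<^esub> inv\<^bsub>T (g j)\<^esub> (\<tau> (g j) (g j) (e j))))"
proof -
  interpret mesh_pair I S \<sigma> s J T \<tau> t using assms by (simp add: mesh_pair_def)
  have gJ: "g i \<in> J" if "i \<in> I" for i using assms(3) that by auto
  show ?thesis (is "?L \<longleftrightarrow> ?R")
  proof
    assume ?L
    then obtain h where h: "h \<in> quandle_hom QS QT"
      and ind: "\<And>i. i \<in> I \<Longrightarrow> component_map QT h (mesh_component S i) = mesh_component T (g i)"
      by blast
    define F where "F = (\<lambda>i a. snd (h (i, a)))"
    \<comment> \<open>The assumption on the induced map enters here and fixes the first coordinate
      of \<open>h\<close>.\<close>
    have "h (i, a) \<in> mesh_component T (g i)" if "i \<in> I" "a \<in> carrier (S i)" for i a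
      using component_map_eqD[OF h that(1) gJ[OF that(1)] ind[OF that(1)]] that
      by (auto simp: mesh_component_def)
    then have hF: "h (i, a) = (g i, F i a)" and F: "F i a \<in> carrier (T (g i))"
      if "i \<in> I" "a \<in> carrier (S i)" for i a
      using that by (force simp: F_def mesh_component_def)+
    have hom_eq: "F j (s i j \<otimes>\<^bsub>S j\<^esub> \<sigma> i j a \<otimes>\<^bsub>S j\<^esub> (b \<otimes>\<^bsub>S j\<^esub> inv\<^bsub>S j\<^esub> (\<sigma> j j b))) =
      t (g i) (g j) \<otimes>\<^bsub>T (g j)\<^esub> \<tau> (g i) (g j) (F i a)
        \<otimes>\<^bsub>T (g j)\<^esub> (F j b \<otimes>\<^bsub>T (g j)\<^esub> inv\<^bsub>T (g j)\<^esub> (\<tau> (g j) (g j) (F j b)))"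
      if "i \<in> I" "j \<in> I" "a \<in> carrier (S i)" "b \<in> carrier (S j)" for i j a b
    proof -
      have "h ((i, a) \<triangleright>\<^bsub>QS\<^esub> (j, b)) = h (i, a) \<triangleright>\<^bsub>QT\<^esub> h (j, b)"
        using h that unfolding quandle_hom_def S.carrier_mesh by blast
      then show ?thesis using that S.op_closed[OF that] by (simp add: S.op_mesh T.op_mesh hF)
    qed
    note aff = hom_imp_affine_family[of g F, OF assms(3) F hom_eq]
    show ?R
      \<comment> \<open>The witnesses are the \<open>k\<close> and \<open>e\<close> of
        \<open>hom_imp_affine_family\<close>, written out in terms of \<open>F\<close>.\<close>
      by (rule exI[of _ "\<lambda>i a. F i a \<otimes>\<^bsub>T (g i)\<^esub> inv\<^bsub>T (g i)\<^esub> F i \<one>\<^bsub>S i\<^esub>"],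
          rule exI[of _ "\<lambda>i. F i \<one>\<^bsub>S i\<^esub>"])
        (intro conjI ballI aff F one_in_S)
  next
    assume ?R
    then obtain k e where
      k: "\<And>i. i \<in> I \<Longrightarrow> k i \<in> hom (S i) (T (g i))"
      and e: "\<And>i. i \<in> I \<Longrightarrow> e i \<in> carrier (T (g i))"
      and k\<sigma>: "\<And>i j a. i \<in> I \<Longrightarrow> j \<in> I \<Longrightarrow> a \<in> carrier (S i) \<Longrightarrow>
        k j (\<sigma> i j a) = \<tau> (g i) (g j) (k i a)"
      and ks: "\<And>i j. i \<in> I \<Longrightarrow> j \<in> I \<Longrightarrow>
        k j (s i j) = t (g i) (g j) \<otimes>\<^bsub>T (g j)\<^esub> \<tau> (g i) (g j) (e i)
          \<otimes>\<^bsub>T (g j)\<^esub> inv\<^bsub>T (g j)\<^esub> (\<tau> (g j) (g j) (e j))"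
      by blast
    let ?h = "\<lambda>(i, a). (g i, e i \<otimes>\<^bsub>T (g i)\<^esub> k i a)"
    have "component_map QT ?h (mesh_component S i) = mesh_component T (g i)" if i: "i \<in> I" for i
    proof (rule component_map_eqI[OF i gJ[OF i]])
      interpret comm_group "T (g i)" using T.comm_group gJ i by blast
      show "?h ` mesh_component S i \<subseteq> mesh_component T (g i)"
        using k[OF i] e[OF i] by (auto simp: mesh_component_def hom_def)
    qed
    moreover have "?h \<in> quandle_hom QS QT"
      using affine_family_imp_hom[OF assms(3) k e k\<sigma> ks] .
    ultimately show ?L by blast
  qed
qed

end
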